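(* Let $G=(V,E)$ be a finite simple graph with $n=|V|\ge 1$ vertices and with no isolated vertices. Then $$f_{\mathrm{oe}}(G)>c_*n>\frac{2n}{21}.$$
   Context: For $S\subseteq V$ and $v\in V$ write $d_S(v):=|N_G(v)\cap S|$, where $N_G(v)$ is the set of neighbours of $v$ in $G$. Given a labeling $\ell:V\to\{0,1\}$, a set $S\subseteq V$ is called $\ell$-admissible if $d_S(v)\equiv \ell(v)\pmod 2$ for every $v\in S$; the empty set is regarded as $\ell$-admissible. Let $\mathcal{A}_\ell(G)$ be the collection of all $\ell$-admissible sets $S\subseteq V$, let $h_\ell(G):=\max\{|S|:S\in\mathcal{A}_\ell(G)\}$, and let $f_{\mathrm{oe}}(G):=\min_{\ell:V\to\{0,1\}}h_\ell(G)$. The constant $c_*$ is defined as follows. Let $$H_2(t):=-t\log_2 t-(1-t)\log_2(1-t)\qquad(0<t<1)$$ be the binary entropy function and let $$\Phi(t):=\frac{1-2t}{4}\log_2(1-2t)-\frac{1-t}{2}\log_2\!\left(\frac{1-t}{2}\right)\qquad(0<t<1/2).$$ The equation $H_2(t)=\Phi(t)$ has exactly one solution in the interval $(0,1/2)$, and $c_*$ denotes this solution. *)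

theory Defs
  imports Complex_Main "HOL-Library.FuncSet" "HOL-Number_Theory.Cong"
    "Graph_Theory.Pair_Digraph"
begin

text \<open>
  A finite simple graph is a \<^locale>\<open>pair_graph\<close>: finite vertex set, and a symmetric loopfree
  arc relation on it, so that an edge $uv$ is represented by both pairs $(u,v)$ and $(v,u)$.
\<close>

definition nbhd :: "'a pair_pre_digraph \<Rightarrow> 'a \<Rightarrow> 'a set" where
  "nbhd G v = {u. (v, u) \<in> parcs G}"

definition isolated :: "'a pair_pre_digraph \<Rightarrow> 'a \<Rightarrow> bool" where
  "isolated G v \<longleftrightarrow> v \<in> pverts G \<and> nbhd G v = {}"

definition deg_in :: "'a pair_pre_digraph \<Rightarrow> 'a set \<Rightarrow> 'a \<Rightarrow> nat" where
  "deg_in G S v = card (nbhd G v \<inter> S)"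

definition admissible_sets :: "'a pair_pre_digraph \<Rightarrow> ('a \<Rightarrow> nat) \<Rightarrow> 'a set set" where
  "admissible_sets G l = {S. S \<subseteq> pverts G \<and> (\<forall>v\<in>S. [deg_in G S v = l v] (mod 2))}"

text \<open>
  For finite \<open>G\<close> the maximum and minimum below range over finite nonempty sets. Labelings are
  taken in the extensional function space, which has one element per map from vertices to labels.
\<close>

definition h_label :: "'a pair_pre_digraph \<Rightarrow> ('a \<Rightarrow> nat) \<Rightarrow> nat" where
  "h_label G l = Max (card ` admissible_sets G l)"

definition f_oe :: "'a pair_pre_digraph \<Rightarrow> nat" where
  "f_oe G = Min (h_label G ` (pverts G \<rightarrow>\<^sub>E {0, 1}))"

definition H2 :: "real \<Rightarrow> real" where
  "H2 t = - t * log 2 t - (1 - t) * log 2 (1 - t)"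

definition Phi :: "real \<Rightarrow> real" where
  "Phi t = (1 - 2 * t) / 4 * log 2 (1 - 2 * t) - (1 - t) / 2 * log 2 ((1 - t) / 2)"

definition c_star :: real where
  "c_star = (THE t. 0 < t \<and> t < 1 / 2 \<and> H2 t = Phi t)"

end

theory Submission
  imports Defs
begin

text \<open>
  The theorem is proved by counting admissible sets, for one arbitrary labelling \<open>l\<close> at a time.
  The indicator of admissibility of \<open>S\<close> is the product over \<open>v \<in> S\<close> of \<open>(1 + s\<^sub>S v) / 2\<close>, where
  \<open>s\<^sub>S v = \<plusminus>1\<close> records whether the degree of \<open>v\<close> into \<open>S\<close> has the parity demanded by \<open>l\<close>.
  Expanding this product over the subsets \<open>T\<close> of \<open>S\<close> and putting \<open>R = S - T\<close>, the handshake lemma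
  lets \<open>s\<^sub>S\<close> be replaced by \<open>s\<^sub>R\<close> on \<open>T\<close>, so that the sum over \<open>T\<close> factorises again
  (\<open>weighted_count_identity\<close>): for every real \<open>y\<close>,

  \<open>\<Sum>S admissible. (2y)^|S| = \<Sum>R \<subseteq> V. y^|R| * (\<Prod>v \<in> V - R. 1 + y * s\<^sub>R v)\<close>.

  For \<open>0 < y < 1\<close> all terms on the right are positive, so their average is at least their geometric
  mean. That mean is explicit: for a uniformly random \<open>R\<close>, a vertex lies in \<open>R\<close> with probability 1/2,
  and because it has a neighbour, \<open>s\<^sub>R v\<close> takes each sign with probability 1/4 outside \<open>R\<close>. Hence
  (\<open>weighted_count_ge\<close>) the weighted count is at least
  \<open>exp (n * (ln 2 + ln y / 2 + ln (1 - y\<^sup>2) / 4))\<close>.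

  Suppose now that every admissible set has at most \<open>t * n\<close> elements. If \<open>2y \<ge> 1\<close>, each weight is at
  most \<open>(2y)^(t * n)\<close>, which gives a lower bound on the number of admissible sets. The choice
  \<open>y\<^sup>2 = (1 - 2t) / (2 - 2t)\<close> makes this bound as large as possible, and its value is then
  \<open>2 powr (Phi t * n)\<close> (\<open>Phi_as_optimised_exponent\<close>). On the other hand, there are fewer than
  \<open>2 powr (H2 t * n)\<close> sets of size at most \<open>t * n\<close> (\<open>card_small_subsets_less\<close>). At \<open>t = c_star\<close>
  the two exponents agree, a contradiction; strictness of the entropy bound yields the strict
  inequality.

  What remains is calculus for \<open>H2 - Phi\<close>: it is negative at 2/21, increases up to 1/4, and
  is positive from 1/4 on, so its only zero lies strictly between 2/21 and 1/4. At 2/21 its sign amounts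
  to the integer inequality \<open>21^63 < 17^17 * 19^38 * 2^46\<close>.
\<close>

section \<open>The entropy bound for families of small sets\<close>

lemma ln_entropy:
  assumes "0 < t" "t < 1"
  shows "H2 t * ln 2 = - t * ln t - (1 - t) * ln (1 - t)"
  using assms by (simp add: H2_def log_def field_simps)

text \<open>
  Under the product measure in which each point is chosen with probability \<open>t < 1/2\<close>, smaller sets
  are more likely, so each set of size at most \<open>t * card V\<close> has probability at least
  \<open>2 powr (- H2 t * card V)\<close>. The inequality is strict because \<open>V\<close> itself has positive probability
  and is not small.
\<close>
lemma card_small_subsets_less:
  fixes t :: real
  assumes V: "finite V" "V \<noteq> {}" and t: "0 < t" "t < 1/2"
    and F: "F \<subseteq> Pow V" "\<And>S. S \<in> F \<Longrightarrow> real (card S) \<le> t * card V"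
  shows "real (card F) < 2 powr (H2 t * card V)"
proof -
  let ?n = "real (card V)"
  define w where "w S = t ^ card S * (1 - t) ^ card (V - S)" for S :: "'a set"
  have n0: "?n > 0" using V by (simp add: card_gt_0_iff)
  have w_pos: "w S > 0" for S using t by (simp add: w_def)
  have lower: "2 powr (- (H2 t * ?n)) \<le> w S" if "S \<in> F" for S
  proof -
    have S: "S \<subseteq> V" "real (card S) \<le> t * ?n" using F that by auto
    have c: "real (card (V - S)) = ?n - card S"
      using S V by (simp add: card_Diff_subset finite_subset card_mono of_nat_diff)
    have "ln t \<le> ln (1 - t)" using t by simp
    hence "(t * ?n - card S) * (ln (1 - t) - ln t) \<ge> 0" using S by simp
    hence "- (H2 t * ln 2 * ?n) \<le> real (card S) * ln t + real (card (V - S)) * ln (1 - t)"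
      unfolding c using t by (subst ln_entropy) (auto simp: algebra_simps)
    also have "\<dots> = ln (w S)"
      using t by (simp add: w_def ln_mult ln_realpow)
    finally have "exp (- (H2 t * ln 2 * ?n)) \<le> exp (ln (w S))" by simp
    thus ?thesis using w_pos[of S] by (simp add: powr_def mult_ac)
  qed
  have finF: "finite F" using F V by (meson finite_Pow_iff finite_subset)
  have "V \<notin> F"
  proof
    assume "V \<in> F"
    hence "?n \<le> t * ?n" using F by blast
    thus False using t n0 by (simp add: mult_le_cancel_right1)
  qed
  hence "F \<subset> Pow V" using F by auto
  hence "sum w F < sum w (Pow V)"
    using V w_pos by (intro sum_strict_mono2[where b = V]) (auto simp: \<open>V \<notin> F\<close> less_imp_le)
  also have "\<dots> = (\<Prod>v\<in>V. t + (1 - t))"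
    unfolding w_def using V by (subst prod_add) auto
  finally have "sum w F < 1" by simp
  moreover have "card F * 2 powr (- (H2 t * ?n)) \<le> sum w F"
    using lower by (rule sum_bounded_below)
  ultimately have "card F * 2 powr (- (H2 t * ?n)) < 1" by simp
  thus ?thesis by (simp add: powr_minus field_simps)
qed

section \<open>The weighted count of admissible sets\<close>

definition parity_sign :: "'a pair_pre_digraph \<Rightarrow> ('a \<Rightarrow> nat) \<Rightarrow> 'a set \<Rightarrow> 'a \<Rightarrow> real" where
  "parity_sign G l S v = (- 1) ^ (deg_in G S v + l v)"

lemma parity_sign_cases: "parity_sign G l S v = 1 \<or> parity_sign G l S v = - 1"
  by (simp add: parity_sign_def minus_one_power_iff)

lemma parity_sign_eq_1_iff: "parity_sign G l S v = 1 \<longleftrightarrow> [deg_in G S v = l v] (mod 2)"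
  unfolding parity_sign_def minus_one_power_iff cong_def by (simp add: even_iff_mod_2_eq_zero; presburger)

context pair_graph
begin

lemma finite_nbhd: "finite (nbhd G v)"
proof -
  have "nbhd G v \<subseteq> pverts G" by (auto simp: nbhd_def dest: in_arcsD2)
  thus ?thesis using pair_finite_verts finite_subset by blast
qed

lemma nbhd_sym: "u \<in> nbhd G v \<longleftrightarrow> v \<in> nbhd G u"
  using pair_sym_arcs by (auto simp: nbhd_def symmetric_def sym_def)

lemma not_in_own_nbhd: "v \<notin> nbhd G v"
  using pair_no_loops[of "(v, v)"] by (auto simp: nbhd_def)

lemma deg_in_disjoint_Un:
  "R \<inter> T = {} \<Longrightarrow> deg_in G (R \<union> T) v = deg_in G R v + deg_in G T v"
  unfolding deg_in_def Int_Un_distrib using finite_nbhd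
  by (intro card_Un_disjoint) auto

lemma even_sum_deg_in: "finite T \<Longrightarrow> even (\<Sum>v\<in>T. deg_in G T v)"
proof (induction T rule: finite_induct)
  case (insert a T)
  have split: "deg_in G (insert a T) v = deg_in G {a} v + deg_in G T v" for v
    using deg_in_disjoint_Un[of "{a}" T v] insert by simp
  have "(\<Sum>v\<in>T. deg_in G {a} v) = (\<Sum>v\<in>T. if v \<in> nbhd G a then 1 else 0)"
    by (intro sum.cong) (auto simp: deg_in_def nbhd_sym[of a])
  also have "\<dots> = deg_in G T a"
    using insert by (simp add: deg_in_def sum.If_cases Int_commute)
  finally have arcs_to_a: "(\<Sum>v\<in>T. deg_in G {a} v) = deg_in G T a" .
  have "deg_in G {a} a = 0" by (simp add: deg_in_def not_in_own_nbhd)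
  hence "(\<Sum>v\<in>insert a T. deg_in G (insert a T) v)
      = 2 * deg_in G T a + (\<Sum>v\<in>T. deg_in G T v)"
    using insert.hyps arcs_to_a by (simp add: split sum.distrib)
  thus ?case using insert.IH by simp
qed simp

text \<open>
  Adding \<open>T\<close> to \<open>R\<close> multiplies the product of signs over \<open>T\<close> by \<open>-1\<close> to the degree sum of the graph
  induced on \<open>T\<close>, which is even.
\<close>
lemma prod_parity_sign_Un:
  assumes "finite T" "R \<inter> T = {}"
  shows "(\<Prod>v\<in>T. parity_sign G l (R \<union> T) v) = (\<Prod>v\<in>T. parity_sign G l R v)"
proof -
  have "(\<Prod>v\<in>T. parity_sign G l (R \<union> T) v)
      = (\<Prod>v\<in>T. (- 1) ^ deg_in G T v * parity_sign G l R v)"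
    using assms by (intro prod.cong) (simp_all add: parity_sign_def deg_in_disjoint_Un power_add)
  also have "\<dots> = (- 1) ^ (\<Sum>v\<in>T. deg_in G T v) * (\<Prod>v\<in>T. parity_sign G l R v)"
    by (simp add: prod.distrib power_sum)
  finally show ?thesis using even_sum_deg_in[OF assms(1)] by simp
qed

text \<open>
  Both sides equal the sum of \<open>y^|S|\<close> times the product of the signs of \<open>T\<close> in \<open>S\<close>, over all pairs
  \<open>T \<subseteq> S\<close> of vertex sets. Summing over \<open>T\<close> first leaves \<open>(2y)^|S|\<close> or 0; fixing \<open>R = S - T\<close> first
  leaves the product on the right. The gain is that the right-hand side has no cancellation between
  different \<open>R\<close> when \<open>0 < y < 1\<close>.
\<close>
lemma weighted_count_identity:
  fixes y :: real
  shows "(\<Sum>S\<in>admissible_sets G l. (2 * y) ^ card S)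
    = (\<Sum>R\<in>Pow (pverts G). y ^ card R * (\<Prod>v\<in>pverts G - R. 1 + y * parity_sign G l R v))"
proof -
  let ?V = "pverts G" and ?s = "parity_sign G l"
  have finV: "finite ?V" by (rule pair_finite_verts)
  have expand: "y ^ card R * (\<Prod>v\<in>?V - R. 1 + y * ?s R v)
      = (\<Sum>T\<in>Pow (?V - R). y ^ card (R \<union> T) * (\<Prod>v\<in>T. ?s (R \<union> T) v))" if R: "R \<subseteq> ?V" for R
  proof -
    have "(\<Prod>v\<in>?V - R. 1 + y * ?s R v) = (\<Prod>v\<in>?V - R. y * ?s R v + 1)"
      by (simp add: add.commute)
    also have "\<dots> = (\<Sum>T\<in>Pow (?V - R). y ^ card T * (\<Prod>v\<in>T. ?s R v))"
      using finV by (subst prod_add) (auto simp: prod.distrib)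
    finally have "y ^ card R * (\<Prod>v\<in>?V - R. 1 + y * ?s R v)
        = (\<Sum>T\<in>Pow (?V - R). y ^ card R * (y ^ card T * (\<Prod>v\<in>T. ?s R v)))"
      by (simp add: sum_distrib_left)
    also have "\<dots> = (\<Sum>T\<in>Pow (?V - R). y ^ card (R \<union> T) * (\<Prod>v\<in>T. ?s (R \<union> T) v))"
    proof (rule sum.cong[OF refl])
      fix T assume T: "T \<in> Pow (?V - R)"
      have fin: "finite R" "finite T" and disj: "R \<inter> T = {}"
        using T R finV by (auto intro: finite_subset)
      show "y ^ card R * (y ^ card T * (\<Prod>v\<in>T. ?s R v))
          = y ^ card (R \<union> T) * (\<Prod>v\<in>T. ?s (R \<union> T) v)"
        using fin disj by (simp add: card_Un_disjoint power_add prod_parity_sign_Un)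
    qed
    finally show ?thesis .
  qed
  have collapse: "(\<Sum>T\<in>Pow S. y ^ card S * (\<Prod>v\<in>T. ?s S v))
      = (if S \<in> admissible_sets G l then (2 * y) ^ card S else 0)" if S: "S \<subseteq> ?V" for S
  proof -
    have finS: "finite S" using S finV finite_subset by blast
    have "(\<Sum>T\<in>Pow S. \<Prod>v\<in>T. ?s S v) = (\<Prod>v\<in>S. ?s S v + 1)"
      using finS by (subst prod_add) auto
    also have "\<dots> = (if S \<in> admissible_sets G l then 2 ^ card S else 0)"
    proof (cases "S \<in> admissible_sets G l")
      case True
      hence "\<And>v. v \<in> S \<Longrightarrow> ?s S v = 1"
        by (auto simp: admissible_sets_def parity_sign_eq_1_iff)
      thus ?thesis using True by simp
    next
      case False
      then obtain v where "v \<in> S" "?s S v \<noteq> 1"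
        using S by (auto simp: admissible_sets_def parity_sign_eq_1_iff)
      hence "v \<in> S" "?s S v = - 1" using parity_sign_cases[of G l S v] by auto
      thus ?thesis using False finS by (auto intro!: prod_zero bexI[of _ v])
    qed
    finally show ?thesis by (simp flip: sum_distrib_left add: power_mult_distrib)
  qed
  have "(\<Sum>R\<in>Pow ?V. y ^ card R * (\<Prod>v\<in>?V - R. 1 + y * ?s R v))
      = (\<Sum>R\<in>Pow ?V. \<Sum>T\<in>Pow (?V - R). y ^ card (R \<union> T) * (\<Prod>v\<in>T. ?s (R \<union> T) v))"
    by (intro sum.cong refl expand) auto
  also have "\<dots> = (\<Sum>(R, T)\<in>Sigma (Pow ?V) (\<lambda>R. Pow (?V - R)).
      y ^ card (R \<union> T) * (\<Prod>v\<in>T. ?s (R \<union> T) v))"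
    using finV by (subst sum.Sigma) auto
  also have "\<dots> = (\<Sum>(S, T)\<in>Sigma (Pow ?V) Pow. y ^ card S * (\<Prod>v\<in>T. ?s S v))"
    by (rule sum.reindex_bij_witness[of _ "\<lambda>(S, T). (S - T, T)" "\<lambda>(R, T). (R \<union> T, T)"])
       (auto simp: Un_absorb2)
  also have "\<dots> = (\<Sum>S\<in>Pow ?V. \<Sum>T\<in>Pow S. y ^ card S * (\<Prod>v\<in>T. ?s S v))"
    using finV by (subst sum.Sigma) (auto intro: finite_subset)
  also have "\<dots> = (\<Sum>S\<in>Pow ?V. if S \<in> admissible_sets G l then (2 * y) ^ card S else 0)"
    by (intro sum.cong refl collapse) auto
  also have "\<dots> = (\<Sum>S\<in>admissible_sets G l. (2 * y) ^ card S)"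
    using finV by (intro sum.mono_neutral_cong_right) (auto simp: admissible_sets_def)
  finally show ?thesis by simp
qed

text \<open>
  The parity of the degree of \<open>v\<close> into a uniformly random set is unbiased as soon as \<open>v\<close> has a
  neighbour \<open>u\<close>: the sum factorises over the vertices, and the factor of \<open>u\<close> is \<open>1 - 1\<close>.
\<close>
lemma sum_parity_sign_eq_0:
  assumes v: "v \<in> pverts G" "nbhd G v \<noteq> {}"
  shows "(\<Sum>R\<in>Pow (pverts G - {v}). parity_sign G l R v) = 0"
proof -
  let ?W = "pverts G - {v}"
  let ?c = "\<lambda>u. if u \<in> nbhd G v then - 1 else 1 :: real"
  obtain u where u: "u \<in> nbhd G v" using v by auto
  have uW: "u \<in> ?W" using u not_in_own_nbhd by (auto simp: nbhd_def dest: in_arcsD2)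
  have fin: "finite ?W" using pair_finite_verts by simp
  have "(\<Sum>R\<in>Pow ?W. parity_sign G l R v) = (\<Sum>R\<in>Pow ?W. (- 1) ^ l v * (\<Prod>u\<in>R. ?c u))"
  proof (rule sum.cong[OF refl])
    fix R assume "R \<in> Pow ?W"
    hence "finite R" using fin finite_subset by blast
    thus "parity_sign G l R v = (- 1) ^ l v * (\<Prod>u\<in>R. ?c u)"
      by (simp add: parity_sign_def power_add deg_in_def prod.If_cases Int_commute)
  qed
  also have "\<dots> = (- 1) ^ l v * (\<Prod>u\<in>?W. ?c u + 1)"
    using fin by (subst prod_add) (auto simp: sum_distrib_left)
  also have "(\<Prod>u\<in>?W. ?c u + 1) = 0"
    using fin uW u by (intro prod_zero) (auto intro!: bexI[of _ u])
  finally show ?thesis by simp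
qed

end

text \<open>
  The inequality of arithmetic and geometric means, from the tangent of \<open>exp\<close> at the mean \<open>m\<close>.
\<close>
lemma sum_exp_ge_exp_mean:
  fixes f :: "'b \<Rightarrow> real" and m :: real
  assumes "sum f A = card A * m"
  shows "card A * exp m \<le> (\<Sum>a\<in>A. exp (f a))"
proof -
  have "exp m * (1 + (f a - m)) \<le> exp (f a)" for a
    using mult_left_mono[OF exp_ge_add_one_self[of "f a - m"], of "exp m"]
    by (simp flip: exp_add)
  hence "(\<Sum>a\<in>A. exp m * (1 + (f a - m))) \<le> (\<Sum>a\<in>A. exp (f a))" by (intro sum_mono)
  also have "(\<Sum>a\<in>A. exp m * (1 + (f a - m))) = card A * exp m"
    using assms by (simp flip: sum_distrib_left add: sum.distrib sum_subtractf)
  finally show ?thesis .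
qed

text \<open>
  The right-hand side of the counting identity is bounded below by its geometric mean. The logarithm
  of a term is a sum of one contribution per vertex, so the mean can be computed vertex by vertex.
\<close>
lemma (in pair_graph) weighted_count_ge:
  fixes y :: real
  assumes y: "0 < y" "y < 1" and iso: "\<And>v. v \<in> pverts G \<Longrightarrow> \<not> isolated G v"
  shows "exp (card (pverts G) * (ln 2 + ln y / 2 + ln (1 - y\<^sup>2) / 4))
    \<le> (\<Sum>S\<in>admissible_sets G l. (2 * y) ^ card S)"
proof -
  let ?V = "pverts G" and ?s = "parity_sign G l" and ?n = "card (pverts G)"
  have finV: "finite ?V" by (rule pair_finite_verts)
  define a b where "a = (ln (1 + y) + ln (1 - y)) / 2" and "b = (ln (1 + y) - ln (1 - y)) / 2"
  have a: "a = ln (1 - y\<^sup>2) / 2"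
  proof -
    have "1 - y\<^sup>2 = (1 + y) * (1 - y)" by (simp add: power2_eq_square algebra_simps)
    thus ?thesis using y by (simp add: a_def ln_mult)
  qed
  \<comment> \<open>The logarithm of a factor becomes affine in the sign, so that only the mean of the sign matters.\<close>
  have ln_factor: "exp (a + b * ?s R v) = 1 + y * ?s R v" for R v
    using parity_sign_cases[of G l R v] y unfolding a_def b_def
    by (auto simp: field_simps simp flip: add_divide_distrib diff_divide_distrib)
  define g where "g v R = (if v \<in> R then ln y else a + b * ?s R v)" for v R
  define m where "m = ?n * (ln y + a) / 2"
  have weight: "y ^ card R * (\<Prod>v\<in>?V - R. 1 + y * ?s R v) = exp (\<Sum>v\<in>?V. g v R)"
    if "R \<in> Pow ?V" for R
  proof -
    have "exp (\<Sum>v\<in>?V. g v R) = (\<Prod>v\<in>?V. exp (g v R))" using finV by (rule exp_sum)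
    also have "\<dots> = (\<Prod>v\<in>?V - R. exp (g v R)) * (\<Prod>v\<in>R. exp (g v R))"
      using that finV by (intro prod.subset_diff) auto
    also have "(\<Prod>v\<in>R. exp (g v R)) = y ^ card R" using y by (simp add: g_def)
    also have "(\<Prod>v\<in>?V - R. exp (g v R)) = (\<Prod>v\<in>?V - R. 1 + y * ?s R v)"
      by (intro prod.cong) (auto simp: g_def ln_factor)
    finally show ?thesis by (simp add: mult.commute)
  qed
  have local_sum: "(\<Sum>R\<in>Pow ?V. g v R) = 2 ^ ?n * ((ln y + a) / 2)" if v: "v \<in> ?V" for v
  proof -
    let ?W = "?V - {v}"
    have n: "?n = Suc (card ?W)" using card.remove[OF finV v] .
    have finW: "finite ?W" using finV by simp
    have nb: "nbhd G v \<noteq> {}" using iso[OF v] v by (simp add: isolated_def)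
    have "(\<Sum>R\<in>Pow ?V. g v R) = (\<Sum>R\<in>Pow ?W. g v R) + (\<Sum>R\<in>insert v ` Pow ?W. g v R)"
    proof -
      have "Pow ?V = Pow ?W \<union> insert v ` Pow ?W"
        using Pow_insert[of v ?W] v by (simp add: insert_absorb)
      thus ?thesis using finW by (simp only:) (intro sum.union_disjoint; auto)
    qed
    also have "(\<Sum>R\<in>insert v ` Pow ?W. g v R) = (\<Sum>R\<in>insert v ` Pow ?W. ln y)"
      by (intro sum.cong) (auto simp: g_def)
    also have "\<dots> = 2 ^ card ?W * ln y"
    proof -
      have "inj_on (insert v) (Pow ?W)" by (auto simp: inj_on_def)
      thus ?thesis using finW by (simp add: card_image card_Pow)
    qed
    also have "(\<Sum>R\<in>Pow ?W. g v R) = (\<Sum>R\<in>Pow ?W. a + b * ?s R v)"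
      by (intro sum.cong) (auto simp: g_def)
    also have "\<dots> = 2 ^ card ?W * a"
      using sum_parity_sign_eq_0[OF v nb, of l] finW
      by (simp add: sum.distrib card_Pow flip: sum_distrib_left)
    finally show ?thesis by (simp add: n algebra_simps)
  qed
  have "(\<Sum>R\<in>Pow ?V. \<Sum>v\<in>?V. g v R) = (\<Sum>v\<in>?V. \<Sum>R\<in>Pow ?V. g v R)" by (rule sum.swap)
  also have "\<dots> = card (Pow ?V) * m"
    using finV by (simp add: local_sum card_Pow m_def)
  finally have "card (Pow ?V) * exp m \<le> (\<Sum>R\<in>Pow ?V. exp (\<Sum>v\<in>?V. g v R))"
    by (rule sum_exp_ge_exp_mean)
  also have "\<dots> = (\<Sum>S\<in>admissible_sets G l. (2 * y) ^ card S)"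
    unfolding weighted_count_identity by (intro sum.cong) (simp_all add: weight)
  also have "card (Pow ?V) * exp m = exp (?n * ln 2 + m)"
    using finV by (simp add: card_Pow exp_add exp_of_nat_mult)
  also have "?n * ln 2 + m = ?n * (ln 2 + ln y / 2 + ln (1 - y\<^sup>2) / 4)"
    by (simp add: m_def a algebra_simps)
  finally show ?thesis .
qed

text \<open>
  The derivative of the left-hand side with respect to \<open>y\<close> vanishes where
  \<open>1 - 2t = y\<^sup>2 / (1 - y\<^sup>2)\<close>, which is the given \<open>y\<close>. So \<open>Phi\<close> is the rate obtained from the best weight.
\<close>
lemma Phi_as_optimised_exponent:
  fixes t y :: real
  assumes t: "0 < t" "t < 1/2" and y: "y = sqrt ((1 - 2 * t) / (2 - 2 * t))"
  shows "ln 2 + ln y / 2 + ln (1 - y\<^sup>2) / 4 - t * ln (2 * y) = Phi t * ln 2"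
proof -
  have y0: "y > 0" using t y by simp
  have y2: "y\<^sup>2 = (1 - 2 * t) / (2 - 2 * t)" using t y by simp
  have c: "ln (2 - 2 * t) = ln 2 + ln (1 - t)"
    using t ln_mult[of 2 "1 - t"] by (simp add: algebra_simps)
  have "2 * ln y = ln (y\<^sup>2)" using y0 by (simp add: ln_realpow)
  also have "\<dots> = ln (1 - 2 * t) - ln 2 - ln (1 - t)"
    unfolding y2 using t by (simp add: ln_div c)
  finally have ly: "ln y = (ln (1 - 2 * t) - ln 2 - ln (1 - t)) / 2" by simp
  have "1 - y\<^sup>2 = 1 / (2 - 2 * t)" unfolding y2 using t by (simp add: field_simps)
  hence l1: "ln (1 - y\<^sup>2) = - ln 2 - ln (1 - t)" using t by (simp add: ln_div c)
  have l2: "ln (2 * y) = ln 2 + ln y" using y0 by (simp add: ln_mult)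
  have l3: "ln ((1 - t) / 2) = ln (1 - t) - ln 2" using t by (simp add: ln_div)
  have "Phi t * ln 2 = (1 - 2 * t) / 4 * (log 2 (1 - 2 * t) * ln 2)
      - (1 - t) / 2 * (log 2 ((1 - t) / 2) * ln 2)"
    by (simp only: Phi_def left_diff_distrib mult.assoc)
  also have "\<dots> = (1 - 2 * t) / 4 * ln (1 - 2 * t) - (1 - t) / 2 * ln ((1 - t) / 2)"
    by (simp add: log_def)
  finally show ?thesis unfolding l1 l2 l3 ly by (simp add: field_simps)
qed

text \<open>
  The bound \<open>t \<le> 1/3\<close> is equivalent to \<open>2y \<ge> 1\<close> for the optimal \<open>y\<close>, so that larger sets carry
  larger weights.
\<close>
lemma (in pair_graph) large_admissible_set:
  fixes t :: real
  assumes V: "pverts G \<noteq> {}" and iso: "\<And>v. v \<in> pverts G \<Longrightarrow> \<not> isolated G v"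
    and t: "0 < t" "t \<le> 1/3" and H: "H2 t \<le> Phi t"
  shows "\<exists>S\<in>admissible_sets G l. real (card S) > t * card (pverts G)"
proof (rule ccontr)
  let ?n = "real (card (pverts G))" and ?A = "admissible_sets G l"
  assume "\<not> ?thesis"
  hence small: "\<And>S. S \<in> ?A \<Longrightarrow> real (card S) \<le> t * ?n" by force
  define y where "y = sqrt ((1 - 2 * t) / (2 - 2 * t))"
  have y0: "0 < y" "y < 1" using t by (simp_all add: y_def)
  have "sqrt ((1/2)\<^sup>2) \<le> y"
    unfolding y_def using t by (intro real_sqrt_le_mono) (simp add: field_simps power2_eq_square)
  hence y1: "1 \<le> 2 * y" by simp
  have "exp (?n * (ln 2 + ln y / 2 + ln (1 - y\<^sup>2) / 4)) \<le> (\<Sum>S\<in>?A. (2 * y) ^ card S)"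
    using y0 iso by (rule weighted_count_ge)
  also have "\<dots> \<le> (\<Sum>S\<in>?A. (2 * y) powr (t * ?n))"
  proof (rule sum_mono)
    fix S assume "S \<in> ?A"
    hence "(2 * y) powr card S \<le> (2 * y) powr (t * ?n)" using small y1 by (intro powr_mono) auto
    thus "(2 * y) ^ card S \<le> (2 * y) powr (t * ?n)" using y0 by (simp add: powr_realpow)
  qed
  also have "\<dots> = card ?A * exp (t * ?n * ln (2 * y))" using y0 by (simp add: powr_def)
  finally have "exp (?n * (ln 2 + ln y / 2 + ln (1 - y\<^sup>2) / 4) - t * ?n * ln (2 * y)) \<le> card ?A"
    by (simp add: exp_diff divide_le_eq)
  also have "?n * (ln 2 + ln y / 2 + ln (1 - y\<^sup>2) / 4) - t * ?n * ln (2 * y)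
      = ?n * (ln 2 + ln y / 2 + ln (1 - y\<^sup>2) / 4 - t * ln (2 * y))" by (simp add: algebra_simps)
  also have "\<dots> = ?n * (Phi t * ln 2)"
    using t by (subst Phi_as_optimised_exponent) (simp_all add: y_def)
  finally have "2 powr (Phi t * ?n) \<le> card ?A" by (simp add: powr_def mult_ac)
  moreover have "card ?A < 2 powr (H2 t * ?n)"
    using V t small pair_finite_verts
    by (intro card_small_subsets_less) (auto simp: admissible_sets_def)
  moreover have "2 powr (H2 t * ?n) \<le> 2 powr (Phi t * ?n)"
    using H by (intro powr_mono mult_right_mono) auto
  ultimately show False by linarith
qed

section \<open>Locating the zero of the entropy gap\<close>

lemma x_log_x_deriv:
  assumes "(u has_real_derivative u') (at t)" "u t > 0"
  shows "((\<lambda>t. u t * log 2 (u t)) has_real_derivative u' * (ln (u t) + 1) / ln 2) (at t)"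
  unfolding log_def using assms
  by (auto intro!: derivative_eq_intros simp: field_simps)

lemma H2_deriv:
  assumes t: "0 < t" "t < 1"
  shows "(H2 has_real_derivative (ln (1 - t) - ln t) / ln 2) (at t)"
proof -
  have H2_eq: "H2 = (\<lambda>x. - (x * log 2 x) - (1 - x) * log 2 (1 - x))"
    by (simp add: H2_def fun_eq_iff)
  have d1: "((\<lambda>x. x * log 2 x) has_real_derivative 1 * (ln t + 1) / ln 2) (at t)"
    by (rule x_log_x_deriv) (use t in \<open>auto intro!: derivative_eq_intros\<close>)
  have d2: "((\<lambda>x. (1 - x) * log 2 (1 - x)) has_real_derivative - 1 * (ln (1 - t) + 1) / ln 2) (at t)"
    by (rule x_log_x_deriv) (use t in \<open>auto intro!: derivative_eq_intros\<close>)
  show ?thesis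
    unfolding H2_eq using DERIV_diff[OF DERIV_minus[OF d1] d2]
    by (rule DERIV_cong) (simp add: field_simps)
qed

lemma Phi_deriv:
  assumes t: "0 < t" "t < 1/2"
  shows "(Phi has_real_derivative (ln (1 - t) - ln 2 - ln (1 - 2 * t)) / (2 * ln 2)) (at t)"
proof -
  have Phi_eq: "Phi = (\<lambda>x. (1 - 2 * x) * log 2 (1 - 2 * x) / 4 - (1 - x) / 2 * log 2 ((1 - x) / 2))"
    by (simp add: Phi_def fun_eq_iff)
  have d1: "((\<lambda>x. (1 - 2 * x) * log 2 (1 - 2 * x)) has_real_derivative
      - 2 * (ln (1 - 2 * t) + 1) / ln 2) (at t)"
    by (rule x_log_x_deriv) (use t in \<open>auto intro!: derivative_eq_intros\<close>)
  have d2: "((\<lambda>x. (1 - x) / 2 * log 2 ((1 - x) / 2)) has_real_derivative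
      - (1/2) * (ln ((1 - t) / 2) + 1) / ln 2) (at t)"
    by (rule x_log_x_deriv) (use t in \<open>auto intro!: derivative_eq_intros\<close>)
  have "ln ((1 - t) / 2) = ln (1 - t) - ln 2" using t by (simp add: ln_div)
  with DERIV_diff[OF DERIV_cdivide[OF d1, of 4] d2] show ?thesis
    unfolding Phi_eq by (elim DERIV_cong) (simp add: field_simps)
qed

lemma entropy_gap_deriv:
  assumes t: "0 < t" "t < 1/2"
  shows "((\<lambda>t. H2 t - Phi t) has_real_derivative
    log 2 (2 * (1 - t) * (1 - 2 * t) / t\<^sup>2) / 2) (at t)"
proof -
  have "ln (2 - 2 * t) = ln 2 + ln (1 - t)"
    using t ln_mult[of 2 "1 - t"] by (simp add: algebra_simps)
  hence ln_arg: "ln (2 * (1 - t) * (1 - 2 * t) / t\<^sup>2)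
      = ln 2 + ln (1 - t) + ln (1 - 2 * t) - 2 * ln t"
    using t by (simp add: ln_div ln_mult ln_realpow)
  have slope: "(ln (1 - t) - ln t) / ln 2 - (ln (1 - t) - ln 2 - ln (1 - 2 * t)) / (2 * ln 2)
      = log 2 (2 * (1 - t) * (1 - 2 * t) / t\<^sup>2) / 2"
    unfolding log_def ln_arg by (simp add: field_simps)
  have "t < 1" using t by simp
  from DERIV_diff[OF H2_deriv[OF t(1) this] Phi_deriv[OF t]] show ?thesis
    unfolding slope .
qed

text \<open>
  The slope is positive as long as \<open>3t\<^sup>2 - 6t + 2 > 0\<close>, that is, up to \<open>1 - 1 / sqrt 3\<close>, about 0.42.
  Beyond this point the gap decreases, so monotonicity is claimed on a convenient shorter interval.
\<close>
lemma entropy_gap_strict_mono: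
  assumes "0 < s" "s < t" "t \<le> 1/4"
  shows "H2 s - Phi s < H2 t - Phi t"
proof (rule DERIV_pos_imp_increasing[OF assms(2)])
  fix x assume x: "s \<le> x" "x \<le> t"
  have "3 * x\<^sup>2 - 6 * x + 2 > 0"
    using x assms zero_le_power2[of x] by linarith
  hence "1 < 2 * (1 - x) * (1 - 2 * x) / x\<^sup>2"
    using x assms by (simp add: field_simps power2_eq_square)
  hence "log 2 (2 * (1 - x) * (1 - 2 * x) / x\<^sup>2) / 2 > 0" by simp
  thus "\<exists>d. ((\<lambda>t. H2 t - Phi t) has_real_derivative d) (at x) \<and> 0 < d"
    using entropy_gap_deriv[of x] x assms by auto
qed

text \<open>
  On this range the crude separation \<open>Phi t \<le> 3/4 < H2 (1/4) \<le> H2 t\<close> suffices; the middle inequality is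
  \<open>3^3 < 2^5\<close>.
\<close>
lemma entropy_gap_pos:
  assumes t: "1/4 \<le> t" "t < 1/2"
  shows "H2 t - Phi t > 0"
proof -
  have "H2 (1/4) \<le> H2 t"
  proof (rule DERIV_nonneg_imp_nondecreasing[OF t(1)])
    fix x :: real assume x: "1/4 \<le> x" "x \<le> t"
    have "(H2 has_real_derivative (ln (1 - x) - ln x) / ln 2) (at x)"
      using x t by (intro H2_deriv) auto
    moreover have "(ln (1 - x) - ln x) / ln 2 \<ge> 0" using x t by simp
    ultimately show "\<exists>d. (H2 has_real_derivative d) (at x) \<and> 0 \<le> d" by blast
  qed
  moreover have "H2 (1/4) > 3/4"
  proof -
    have "3 * ln 3 < 5 * ln (2 :: real)"
    proof -
      have "3 * ln 3 = ln (27 :: real)" using ln_realpow[of "3::real" 3] by simp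
      also have "\<dots> < ln 32" by (subst ln_less_cancel_iff) auto
      also have "\<dots> = 5 * ln (2 :: real)" using ln_realpow[of "2::real" 5] by simp
      finally show ?thesis .
    qed
    moreover have "H2 (1/4) * ln 2 = 2 * ln 2 - 3/4 * ln 3"
      using ln_realpow[of "2::real" 2] by (subst ln_entropy) (simp_all add: ln_div field_simps)
    ultimately have "3/4 * ln 2 < H2 (1/4) * ln 2" by linarith
    thus ?thesis by simp
  qed
  moreover have "Phi t \<le> 3/4"
  proof -
    have "log 2 (1 - 2 * t) \<le> 0" using t by simp
    hence "(1 - 2 * t) / 4 * log 2 (1 - 2 * t) \<le> 0"
      using t by (intro mult_nonneg_nonpos) auto
    moreover have "log 2 ((1 - t) / 2) \<ge> - 2"
      using t by (subst le_log_iff) (simp_all add: powr_minus)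
    hence "(1 - t) / 2 * - log 2 ((1 - t) / 2) \<le> 3/8 * 2"
      using t by (intro mult_mono) auto
    ultimately show ?thesis by (simp add: Phi_def)
  qed
  ultimately show ?thesis by linarith
qed

text \<open>
  Multiplying \<open>H2 (2/21) < Phi (2/21)\<close> by 84 makes all coefficients integral; exponentiation leaves a comparison of
  two integers.
\<close>
lemma entropy_gap_neg: "H2 (2/21) - Phi (2/21) < 0"
proof -
  have ln_compare: "63 * ln x < 17 * ln a + 38 * ln b + 46 * ln c"
    if "x ^ 63 < a ^ 17 * b ^ 38 * c ^ 46" "0 < x" "0 < a" "0 < b" "0 < c" for x a b c :: real
  proof -
    have "ln (x ^ 63) < ln (a ^ 17 * b ^ 38 * c ^ 46)"
      using that by (subst ln_less_cancel_iff) auto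
    thus ?thesis using that by (simp add: ln_mult ln_realpow)
  qed
  have key: "63 * ln 21 < 17 * ln 17 + 38 * ln 19 + 46 * ln (2 :: real)"
    by (rule ln_compare) simp_all
  have l42: "ln 42 = ln 2 + ln (21::real)" using ln_mult[of "2::real" 21] by simp
  have "84 * (H2 (2/21) * ln 2) = 84 * ln 21 - 8 * ln 2 - 76 * ln 19"
    by (subst ln_entropy) (simp_all add: ln_div field_simps)
  moreover have "84 * (Phi (2/21) * ln 2) = 17 * ln 17 + 21 * ln 21 - 38 * ln 19 + 38 * ln 2"
    by (simp add: Phi_def log_def ln_div l42 field_simps)
  ultimately have "H2 (2/21) * ln 2 < Phi (2/21) * ln 2" using key by linarith
  thus ?thesis by simp
qed

lemma c_star_root: "2/21 < c_star" "c_star < 1/4" "H2 c_star = Phi c_star"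
proof -
  have "continuous_on {2/21..1/4} (\<lambda>t. H2 t - Phi t)"
    using entropy_gap_deriv
    by (intro continuous_at_imp_continuous_on ballI DERIV_isCont) (fastforce intro!: entropy_gap_deriv)
  then obtain c where c: "2/21 \<le> c" "c \<le> 1/4" "H2 c - Phi c = 0"
    using IVT'[of "\<lambda>t. H2 t - Phi t" "2/21" 0 "1/4"] entropy_gap_neg entropy_gap_pos[of "1/4"]
    by fastforce
  have "c \<noteq> 2/21" using c(3) entropy_gap_neg by (metis less_irrefl)
  moreover have "c \<noteq> 1/4"
    using c(3) entropy_gap_pos[of "1/4"] by force
  moreover
  have "c_star = c"
    unfolding c_star_def
  proof (rule the_equality)
    show "0 < c \<and> c < 1 / 2 \<and> H2 c = Phi c" using c by auto
    fix t assume t: "0 < t \<and> t < 1 / 2 \<and> H2 t = Phi t"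
    hence "t < 1/4" using entropy_gap_pos[of t] by force
    thus "t = c"
      using t c entropy_gap_strict_mono[of t c] entropy_gap_strict_mono[of c t] by force
  qed
  ultimately show "2/21 < c_star" "c_star < 1/4" "H2 c_star = Phi c_star" using c by auto
qed

theorem theorem1p1:
  fixes G :: "'a pair_pre_digraph" and n :: nat
  assumes "pair_graph G"
    and "n = card (pverts G)" and "n \<ge> 1"
    and "\<And>v. v \<in> pverts G \<Longrightarrow> \<not> isolated G v"
  shows "real (f_oe G) > c_star * real n \<and> c_star * real n > 2 * real n / 21"
proof
  interpret pair_graph G by fact
  have finV: "finite (pverts G)" by (rule pair_finite_verts)
  have V: "pverts G \<noteq> {}" using assms(2,3) by auto
  have h: "real (h_label G l) > c_star * real n" for l
  proof -
    have "finite (admissible_sets G l)"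
      using finV by (auto simp: admissible_sets_def intro: finite_subset[of _ "Pow (pverts G)"])
    moreover obtain S where S: "S \<in> admissible_sets G l" "real (card S) > c_star * real n"
      using large_admissible_set[OF V assms(4), of c_star l] c_star_root assms(2) by force
    ultimately have "card S \<le> h_label G l" by (simp add: h_label_def)
    thus ?thesis using S by linarith
  qed
  have "f_oe G \<in> h_label G ` (pverts G \<rightarrow>\<^sub>E {0, 1})"
    unfolding f_oe_def using finV by (intro Min_in) (auto simp: finite_PiE PiE_eq_empty_iff)
  thus "real (f_oe G) > c_star * real n" using h by auto
  show "c_star * real n > 2 * real n / 21" using c_star_root(1) assms(3) by (simp add: field_simps)
qed

end
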